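(* Let $(X,\neg,\preceq)$ be a tuple in class $\mathcal{C}$ and let $P,Q\in X$. Suppose there exists $0\in Z$ such that $P\succ 0$. Consider the four statements $$A:\ P\preceq Q,\qquad E:\ P\preceq \neg Q,\qquad I:\ P\not\preceq \neg Q,\qquad O:\ P\not\preceq Q.$$ Then: \begin{itemize} \item $A\Rightarrow I$. \item $E\Rightarrow O$. \item $A$ and $E$ cannot both be true. \item $I$ and $O$ cannot both be false. \item $A$ is equivalent to the negation of $O$. \item $E$ is equivalent to the negation of $I$. \end{itemize}
   Context: A tuple $(X,\neg,\preceq)$ is in class $\mathcal{C}$ if: (i) $\neg:X\to X$ is an involutory unary operation on the set $X$, i.e. $\neg(\neg(x))=x$ for all $x\in X$; (ii) $\preceq$ is a (reflexive, antisymmetric, transitive) partial order on $X$; (iii) for all $a,b\in X$, $a\preceq b$ if and only if $\neg b\preceq\neg a$; (iv) there exists an element $0\in X$ such that $\neg 0\preceq 0$. The (nonempty) set of zeros is $Z=\{x\in X:\neg x\preceq x\}$; the symbol $0$ denotes an element of $Z$ (not necessarily unique). $P\prec Q$ means $P\preceq Q$ and $P\neq Q$; $P\succ Q$ means $Q\prec P$; $P\not\preceq Q$ is the negation of $P\preceq Q$. *)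

theory Defs
  imports Main
begin

text \<open>
  The operation \<open>neg\<close> and the relation \<open>le\<close> are total HOL functions; only their
  behaviour on the carrier \<open>X\<close> is constrained.
\<close>

definition zeros :: "'a set \<Rightarrow> ('a \<Rightarrow> 'a) \<Rightarrow> ('a \<Rightarrow> 'a \<Rightarrow> bool) \<Rightarrow> 'a set" where
  "zeros X neg le = {x \<in> X. le (neg x) x}"

definition strict :: "('a \<Rightarrow> 'a \<Rightarrow> bool) \<Rightarrow> 'a \<Rightarrow> 'a \<Rightarrow> bool" where
  "strict le P Q \<longleftrightarrow> le P Q \<and> P \<noteq> Q"

locale class_C =
  fixes X :: "'a set"
    and neg :: "'a \<Rightarrow> 'a"
    and le :: "'a \<Rightarrow> 'a \<Rightarrow> bool"
  assumes neg_closed: "x \<in> X \<Longrightarrow> neg x \<in> X"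
    and neg_involutory: "x \<in> X \<Longrightarrow> neg (neg x) = x"
    and le_refl: "reflp_on X le"
    and le_antisym: "antisymp_on X le"
    and le_trans: "transp_on X le"
    and contraposition: "\<lbrakk>a \<in> X; b \<in> X\<rbrakk> \<Longrightarrow> le a b \<longleftrightarrow> le (neg b) (neg a)"
    and zero_exists: "\<exists>z\<in>X. le (neg z) z"

text \<open>
  \<open>prop_A\<close> and \<open>prop_O\<close> do not depend on \<open>neg\<close>; they take it so that all four propositions
  have the same signature.
\<close>

definition prop_A :: "('a \<Rightarrow> 'a) \<Rightarrow> ('a \<Rightarrow> 'a \<Rightarrow> bool) \<Rightarrow> 'a \<Rightarrow> 'a \<Rightarrow> bool" where
  "prop_A neg le P Q \<longleftrightarrow> le P Q"

definition prop_E :: "('a \<Rightarrow> 'a) \<Rightarrow> ('a \<Rightarrow> 'a \<Rightarrow> bool) \<Rightarrow> 'a \<Rightarrow> 'a \<Rightarrow> bool" where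
  "prop_E neg le P Q \<longleftrightarrow> le P (neg Q)"

definition prop_I :: "('a \<Rightarrow> 'a) \<Rightarrow> ('a \<Rightarrow> 'a \<Rightarrow> bool) \<Rightarrow> 'a \<Rightarrow> 'a \<Rightarrow> bool" where
  "prop_I neg le P Q \<longleftrightarrow> \<not> le P (neg Q)"

definition prop_O :: "('a \<Rightarrow> 'a) \<Rightarrow> ('a \<Rightarrow> 'a \<Rightarrow> bool) \<Rightarrow> 'a \<Rightarrow> 'a \<Rightarrow> bool" where
  "prop_O neg le P Q \<longleftrightarrow> \<not> le P Q"

end

theory Submission
  imports Defs
begin

text \<open>
  The definitions make \<open>O\<close> the negation of \<open>A\<close> and \<open>I\<close> the negation of \<open>E\<close>, so every clause
  reduces to one fact: \<open>A\<close> and \<open>E\<close> exclude each other. If both held, contraposition would turn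
  \<open>P \<preceq> \<not>Q\<close> into \<open>Q \<preceq> \<not>P\<close>, and with \<open>P \<preceq> Q\<close> this yields \<open>P \<preceq> \<not>P\<close>: \<open>P\<close> lies below its
  own negation. An element strictly above a zero cannot do that (\<open>not_le_neg_above_zero\<close>).
\<close>

context class_C
begin

lemma le_transD: "\<lbrakk>le x y; le y z; x \<in> X; y \<in> X; z \<in> X\<rbrakk> \<Longrightarrow> le x z"
  using le_trans by (blast dest: transp_onD)

text \<open>
  Negation reverses \<open>z \<preceq> p\<close>, so \<open>p \<preceq> \<not>p\<close> would close the cycle
  \<open>p \<preceq> \<not>p \<preceq> \<not>z \<preceq> z \<preceq> p\<close>, which antisymmetry collapses to \<open>z = p\<close>.
\<close>

lemma not_le_neg_above_zero:
  assumes z: "z \<in> zeros X neg le" and p: "p \<in> X" and zp: "strict le z p"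
  shows "\<not> le p (neg p)"
proof
  assume p_neg: "le p (neg p)"
  have zX: "z \<in> X" and z_zero: "le (neg z) z"
    using z by (auto simp: zeros_def)
  have le_zp: "le z p" and "z \<noteq> p"
    using zp by (auto simp: strict_def)
  have "le (neg p) (neg z)"
    using contraposition[OF zX p] le_zp by simp
  with p_neg have "le p (neg z)"
    by (rule le_transD) (simp_all add: p zX neg_closed)
  from this z_zero have "le p z"
    by (rule le_transD) (simp_all add: p zX neg_closed)
  with le_antisym le_zp zX p have "z = p"
    by (blast dest: antisymp_onD)
  with \<open>z \<noteq> p\<close> show False ..
qed

lemma le_neg_self_if_le_both:
  assumes p: "p \<in> X" and q: "q \<in> X" and "le p q" and "le p (neg q)"
  shows "le p (neg p)"
proof -
  have "le q (neg p)"
    using contraposition[OF p neg_closed[OF q]] \<open>le p (neg q)\<close> neg_involutory[OF q] by simp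
  with \<open>le p q\<close> show ?thesis
    by (rule le_transD) (simp_all add: p q neg_closed)
qed

end

theorem theorem1:
  fixes X :: "'a set"
    and neg :: "'a \<Rightarrow> 'a"
    and le :: "'a \<Rightarrow> 'a \<Rightarrow> bool"
    and P Q :: 'a
  assumes "class_C X neg le"
    and "P \<in> X" and "Q \<in> X"
    and "\<exists>z \<in> zeros X neg le. strict le z P"
  shows "(prop_A neg le P Q \<longrightarrow> prop_I neg le P Q) \<and>
         (prop_E neg le P Q \<longrightarrow> prop_O neg le P Q) \<and>
         \<not> (prop_A neg le P Q \<and> prop_E neg le P Q) \<and>
         \<not> (\<not> prop_I neg le P Q \<and> \<not> prop_O neg le P Q) \<and>
         (prop_A neg le P Q \<longleftrightarrow> \<not> prop_O neg le P Q) \<and>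
         (prop_E neg le P Q \<longleftrightarrow> \<not> prop_I neg le P Q)"
proof -
  interpret class_C X neg le by fact
  have "\<not> (le P Q \<and> le P (neg Q))"
    using assms(2-4) not_le_neg_above_zero le_neg_self_if_le_both by blast
  then show ?thesis
    by (auto simp: prop_A_def prop_E_def prop_I_def prop_O_def)
qed

end
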